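(* Let $(B,\mathbf{C}^t_B)$ be a tangled closure algebra whose induced closure algebra $(B,\mathbf{C}_B)$ is totally disconnected and dissectable, and let $\alpha$ be any non-zero open element of $(B,\mathbf{C}_B)$. Then every finite tangled closure algebra $(A,\mathbf{C}^t_A)$ is isomorphic to a subalgebra of the relativised algebra $(B_\alpha,\mathbf{C}^t_\alpha)$; i.e. there is an injective Boolean homomorphism $f:A\to B_\alpha$ with $f(\mathbf{C}^t_A\varGamma)=\mathbf{C}^t_\alpha\{f\gamma:\gamma\in\varGamma\}$ for all finite non-empty $\varGamma\subseteq A$.
   Context: A Boolean algebra $A$ has operations $\land,\lor,-,0,1$; $a\Rightarrow b=-a\lor b$. A closure operator on $A$ is $\mathbf{C}:A\to A$ with $\mathbf{C}(a\lor b)=\mathbf{C}a\lor\mathbf{C}b$, $\mathbf{C}0=0$, $a\leq\mathbf{C}a=\mathbf{C}\mathbf{C}a$; interior $\mathbf{I}a=-\mathbf{C}-a$; $a$ is open if $\mathbf{I}a=a$. For $\mathbf{C}^t$ from finite non-empty subsets of $A$ to $A$, the induced $\mathbf{C}a=\mathbf{C}^t\{a\}$, $\mathbf{I}a=-\mathbf{C}^t\{-a\}$; $(A,\mathbf{C}^t)$ is a tangled closure algebra if $\mathbf{C}$ is a closure operator and for all finite non-empty $\varGamma\subseteq A$ and $a\in A$: (Fix) $\mathbf{C}^t\varGamma\leq\bigwedge_{\gamma\in\varGamma}\mathbf{C}(\gamma\land\mathbf{C}^t\varGamma)$; (Ind) $\mathbf{I}(a\Rightarrow\bigwedge_{\gamma\in\varGamma}\mathbf{C}(\gamma\land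 a))\land a\leq\mathbf{C}^t\varGamma$. Relativisation to $\alpha\in B$: $B_\alpha=\{b\in B:b\leq\alpha\}$ with the same joins and meets, top $\alpha$, complement $b\mapsto\alpha\land-b$; $\mathbf{C}_\alpha b=\alpha\land\mathbf{C}_Bb$; $\mathbf{C}^t_\alpha\varGamma=\alpha\land\mathbf{C}^t_B\varGamma$. A closure algebra $(B,\mathbf{C}_B)$ is dissectable if for every non-zero open $\alpha\in B$ and all natural numbers $r,s$ there exist non-zero $\alpha_1,\dots,\alpha_r,\beta_1,\dots,\beta_s\in B$ which are pairwise disjoint with join $\alpha$, such that $\alpha_1,\dots,\alpha_r$ are open, and for all $1\le i\leq r$, $1\le j\leq s$: $\mathbf{C}_B\alpha_i\land-\alpha_i=\mathbf{C}_B\beta_j=\mathbf{C}_B\alpha\land-(\alpha_1\lor\cdots\lor\alpha_r)$ (for $r=0$ the sequence of $\alpha_i$ is empty). It is totally disconnected if every non-zero open element is the join of two disjoint non-zero open elements. *)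

theory Defs
  imports Main
begin

unbundle lattice_syntax

definition closure_operator :: "('a::boolean_algebra \<Rightarrow> 'a) \<Rightarrow> bool" where
  "closure_operator C \<longleftrightarrow>
     (\<forall>a b. C (a \<squnion> b) = C a \<squnion> C b) \<and> C \<bottom> = \<bottom> \<and> (\<forall>a. a \<le> C a \<and> C a = C (C a))"

definition interior_op :: "('a::boolean_algebra \<Rightarrow> 'a) \<Rightarrow> 'a \<Rightarrow> 'a" where
  "interior_op C a = - C (- a)"

definition open_element :: "('a::boolean_algebra \<Rightarrow> 'a) \<Rightarrow> 'a \<Rightarrow> bool" where
  "open_element C a \<longleftrightarrow> interior_op C a = a"

definition bimp :: "'a::boolean_algebra \<Rightarrow> 'a \<Rightarrow> 'a" where
  "bimp a b = - a \<squnion> b"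

definition induced_closure :: "('a::boolean_algebra set \<Rightarrow> 'a) \<Rightarrow> 'a \<Rightarrow> 'a" where
  "induced_closure Ct a = Ct {a}"

text \<open>A tangled closure operation is only meaningful on finite non-empty sets; it is represented by
  a total function whose values on other sets are unconstrained and never used.\<close>

definition tangled_closure_algebra :: "('a::boolean_algebra set \<Rightarrow> 'a) \<Rightarrow> bool" where
  "tangled_closure_algebra Ct \<longleftrightarrow>
     closure_operator (induced_closure Ct) \<and>
     (\<forall>\<Gamma>. finite \<Gamma> \<and> \<Gamma> \<noteq> {} \<longrightarrow>
        Ct \<Gamma> \<le> Inf_fin ((\<lambda>\<gamma>. induced_closure Ct (\<gamma> \<sqinter> Ct \<Gamma>)) ` \<Gamma>)) \<and>
     (\<forall>\<Gamma> a. finite \<Gamma> \<and> \<Gamma> \<noteq> {} \<longrightarrow>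
        interior_op (induced_closure Ct)
          (bimp a (Inf_fin ((\<lambda>\<gamma>. induced_closure Ct (\<gamma> \<sqinter> a)) ` \<Gamma>))) \<sqinter> a \<le> Ct \<Gamma>)"

definition list_join :: "'a::boolean_algebra list \<Rightarrow> 'a" where
  "list_join xs = foldr (\<squnion>) xs \<bottom>"

text \<open>The elements \<open>\<alpha>\<^sub>1, \<dots>, \<alpha>\<^sub>r\<close> and \<open>\<beta>\<^sub>1, \<dots>, \<beta>\<^sub>s\<close> are the entries of the lists \<open>as\<close> and \<open>bs\<close>;
  since disjointness is symmetric, \<open>sorted_wrt\<close> expresses disjointness of any two entries at
  different positions. The number \<open>s\<close> is positive: for \<open>r = s = 0\<close> a non-zero \<open>\<alpha>\<close> would have to be
  the empty join. The conditions on the \<open>\<alpha>\<^sub>i\<close> and on the \<open>\<beta>\<^sub>j\<close> are separate quantifications, so that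
  for \<open>r = 0\<close> the requirement \<open>C \<beta>\<^sub>j = C \<alpha>\<close> remains.\<close>

definition dissectable :: "('a::boolean_algebra \<Rightarrow> 'a) \<Rightarrow> bool" where
  "dissectable C \<longleftrightarrow>
     (\<forall>\<alpha> (r::nat) (s::nat). open_element C \<alpha> \<and> \<alpha> \<noteq> \<bottom> \<and> s \<ge> 1 \<longrightarrow>
        (\<exists>as bs. length as = r \<and> length bs = s \<and>
           (\<forall>x \<in> set (as @ bs). x \<noteq> \<bottom>) \<and>
           sorted_wrt (\<lambda>x y. x \<sqinter> y = \<bottom>) (as @ bs) \<and>
           list_join (as @ bs) = \<alpha> \<and>
           (\<forall>a \<in> set as. open_element C a) \<and>
           (\<forall>a \<in> set as. C a \<sqinter> - a = C \<alpha> \<sqinter> - list_join as) \<and>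
           (\<forall>b \<in> set bs. C b = C \<alpha> \<sqinter> - list_join as)))"

definition totally_disconnected :: "('a::boolean_algebra \<Rightarrow> 'a) \<Rightarrow> bool" where
  "totally_disconnected C \<longleftrightarrow>
     (\<forall>\<alpha>. open_element C \<alpha> \<and> \<alpha> \<noteq> \<bottom> \<longrightarrow>
        (\<exists>a b. open_element C a \<and> open_element C b \<and> a \<noteq> \<bottom> \<and> b \<noteq> \<bottom> \<and>
               a \<sqinter> b = \<bottom> \<and> a \<squnion> b = \<alpha>))"

definition rel_carrier :: "'b::boolean_algebra \<Rightarrow> 'b set" where
  "rel_carrier \<alpha> = {b. b \<le> \<alpha>}"

definition rel_compl :: "'b::boolean_algebra \<Rightarrow> 'b \<Rightarrow> 'b" where
  "rel_compl \<alpha> b = \<alpha> \<sqinter> - b"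

definition rel_tangle :: "'b::boolean_algebra \<Rightarrow> ('b set \<Rightarrow> 'b) \<Rightarrow> 'b set \<Rightarrow> 'b" where
  "rel_tangle \<alpha> Ct \<Gamma> = \<alpha> \<sqinter> Ct \<Gamma>"

definition boolean_hom_rel :: "('a::boolean_algebra \<Rightarrow> 'b::boolean_algebra) \<Rightarrow> 'b \<Rightarrow> bool" where
  "boolean_hom_rel f \<alpha> \<longleftrightarrow>
     range f \<subseteq> rel_carrier \<alpha> \<and>
     (\<forall>x y. f (x \<squnion> y) = f x \<squnion> f y) \<and>
     (\<forall>x y. f (x \<sqinter> y) = f x \<sqinter> f y) \<and>
     (\<forall>x. f (- x) = rel_compl \<alpha> (f x)) \<and>
     f \<bottom> = \<bottom> \<and> f \<top> = \<alpha>"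

end

theory Submission
  imports Defs
begin

text \<open>A tangled closure is the greatest \<open>a\<close> with \<open>a \<le> C (\<gamma> \<sqinter> a)\<close> for all \<open>\<gamma> \<in> \<Gamma>\<close>, so
  it is determined by \<open>C\<close>, and every embedding \<open>f\<close> of the closure algebra of a finite \<open>A\<close> preserves
  it: if \<open>b\<close> is the tangled closure of the image of \<open>\<Gamma>\<close>, then the least \<open>a\<close> with \<open>b \<le> f a\<close> is
  again such a post-fixed point, hence below the tangled closure of \<open>\<Gamma>\<close>.

  The closure embedding comes from a partition of \<open>\<alpha>\<close> indexed by the atoms of \<open>A\<close> that reflects their
  preorder \<open>w \<le> C v\<close>. For a finite preorder with a root \<open>x\<close> it is built by induction: dissect \<open>\<alpha>\<close>
  with one \<open>\<beta>\<close> for each element of the cluster of \<open>x\<close> and one open \<open>\<alpha>\<^sub>t\<close> for each \<open>t\<close> strictly above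
  \<open>x\<close>, and partition each \<open>\<alpha>\<^sub>t\<close> according to the up-set of \<open>t\<close>. To make the \<open>\<beta>\<close>s lie in the closure
  of all pieces above them, the induction also provides that the closure of each piece contains
  the boundary \<open>C \<alpha> \<sqinter> - \<alpha>\<close>. In general, total disconnectedness splits \<open>\<alpha>\<close> into one open part for
  the up-set of each atom.\<close>

section \<open>Finite joins\<close>

context bounded_semilattice_sup_bot
begin

sublocale finite_join: semilattice_order_neutr_set sup bot greater_eq greater
  defines finite_join = finite_join.F ..

end

lemma list_join_eq_finite_join: "list_join xs = finite_join (set xs)"
  by (induction xs) (simp_all add: list_join_def)

lemma finite_join_eq_bot_iff:
  fixes A :: "'b::bounded_lattice_bot set"
  assumes "finite A"
  shows "finite_join A = \<bottom> \<longleftrightarrow> (\<forall>a\<in>A. a = \<bottom>)"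
  using finite_join.bounded_iff[OF assms, of \<bottom>] by (simp add: bot_unique)

lemma finite_join_disjoint_iff:
  fixes A :: "'b::boolean_algebra set"
  assumes "finite A"
  shows "finite_join A \<sqinter> c = \<bottom> \<longleftrightarrow> (\<forall>a\<in>A. a \<sqinter> c = \<bottom>)"
  using assms by (simp add: inf_shunt finite_join.bounded_iff)

lemma disjoint_finite_joins_iff:
  fixes A B :: "'b::boolean_algebra set"
  assumes "finite A" and "finite B"
  shows "finite_join A \<sqinter> finite_join B = \<bottom> \<longleftrightarrow> (\<forall>a\<in>A. \<forall>b\<in>B. a \<sqinter> b = \<bottom>)"
  using finite_join_disjoint_iff[OF assms(2)]
  by (simp add: finite_join_disjoint_iff[OF assms(1)]) (simp add: inf_commute)

lemma disjoint_mono: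
  fixes a b c d :: "'b::bounded_lattice_bot"
  assumes "a \<le> c" and "b \<le> d" and "c \<sqinter> d = \<bottom>"
  shows "a \<sqinter> b = \<bottom>"
  using inf_mono[OF assms(1,2)] assms(3) by (simp add: bot_unique)

lemma finite_join_swap:
  fixes p :: "'t \<Rightarrow> 'i \<Rightarrow> 'b::bounded_semilattice_sup_bot"
  assumes "finite T" and "\<And>t. t \<in> T \<Longrightarrow> finite (V t)"
  shows "finite_join ((\<lambda>y. finite_join ((\<lambda>t. p t y) ` {t \<in> T. y \<in> V t})) ` (\<Union>t\<in>T. V t)) =
    finite_join ((\<lambda>t. finite_join (p t ` V t)) ` T)" (is "?l = ?r")
proof (rule order.antisym)
  have same_bounds: "?l \<le> c \<longleftrightarrow> ?r \<le> c" for c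
    using assms by (auto simp: finite_join.bounded_iff)
  show "?l \<le> ?r"
    by (rule same_bounds[THEN iffD2, OF order.refl])
  show "?r \<le> ?l"
    by (rule same_bounds[THEN iffD1, OF order.refl])
qed

section \<open>Indexed partitions\<close>

definition indexed_partition :: "('i \<Rightarrow> 'b::boolean_algebra) \<Rightarrow> 'i set \<Rightarrow> 'b \<Rightarrow> bool" where
  "indexed_partition p S a \<longleftrightarrow>
     finite S \<and> (\<forall>s\<in>S. p s \<noteq> \<bottom>) \<and> pairwise (\<lambda>s t. p s \<sqinter> p t = \<bottom>) S \<and> finite_join (p ` S) = a"

lemma indexed_partition_finite: "indexed_partition p S a \<Longrightarrow> finite S"
  by (simp add: indexed_partition_def)

lemma indexed_partition_nonzero: "indexed_partition p S a \<Longrightarrow> s \<in> S \<Longrightarrow> p s \<noteq> \<bottom>"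
  by (simp add: indexed_partition_def)

lemma indexed_partition_disjoint:
  "indexed_partition p S a \<Longrightarrow> s \<in> S \<Longrightarrow> t \<in> S \<Longrightarrow> s \<noteq> t \<Longrightarrow> p s \<sqinter> p t = \<bottom>"
  by (auto simp: indexed_partition_def pairwise_def)

lemma indexed_partition_join: "indexed_partition p S a \<Longrightarrow> finite_join (p ` S) = a"
  by (simp add: indexed_partition_def)

lemma indexed_partition_le: "indexed_partition p S a \<Longrightarrow> s \<in> S \<Longrightarrow> p s \<le> a"
  by (auto simp: indexed_partition_def intro: finite_join.coboundedI)

lemma indexed_partition_subset:
  assumes "indexed_partition p S a" and "T \<subseteq> S"
  shows "indexed_partition p T (finite_join (p ` T))"
  using assms unfolding indexed_partition_def
  by (auto intro: finite_subset pairwise_subset)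

lemma indexed_partition_Un:
  assumes p: "indexed_partition p S a" and q: "indexed_partition q T b"
    and disjoint_indices: "S \<inter> T = {}" and disjoint_joins: "a \<sqinter> b = \<bottom>"
  shows "indexed_partition (override_on p q T) (S \<union> T) (a \<squnion> b)"
proof -
  let ?r = "override_on p q T"
  have on_S: "?r s = p s" if "s \<in> S" for s
    using that disjoint_indices by (auto simp: override_on_def)
  have on_T: "?r t = q t" if "t \<in> T" for t
    using that by simp
  have cross_disjoint: "p s \<sqinter> q t = \<bottom>" "q t \<sqinter> p s = \<bottom>" if "s \<in> S" "t \<in> T" for s t
    using disjoint_mono[OF indexed_partition_le[OF p that(1)] indexed_partition_le[OF q that(2)] disjoint_joins]
    by (simp_all add: inf_commute)
  have "?r s \<sqinter> ?r t = \<bottom>" if "s \<in> S \<union> T" "t \<in> S \<union> T" "s \<noteq> t" for s t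
    using that on_S on_T cross_disjoint indexed_partition_disjoint[OF p] indexed_partition_disjoint[OF q]
    by auto
  moreover have "finite_join (?r ` (S \<union> T)) = a \<squnion> b"
  proof -
    have "?r ` (S \<union> T) = p ` S \<union> q ` T"
      using on_S on_T by (simp add: image_Un cong: image_cong_simp)
    then show ?thesis
      using p q by (simp add: indexed_partition_def finite_join.union)
  qed
  ultimately show ?thesis
    using on_S on_T indexed_partition_finite[OF p] indexed_partition_finite[OF q]
      indexed_partition_nonzero[OF p] indexed_partition_nonzero[OF q]
    by (auto simp: indexed_partition_def pairwise_def)
qed

lemma indexed_partition_refine:
  assumes a: "indexed_partition a T \<alpha>"
    and p: "\<And>t. t \<in> T \<Longrightarrow> indexed_partition (p t) (V t) (a t)"
  shows "indexed_partition (\<lambda>y. finite_join ((\<lambda>t. p t y) ` {t \<in> T. y \<in> V t})) (\<Union>t\<in>T. V t) \<alpha>"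
    (is "indexed_partition ?q ?U \<alpha>")
proof -
  have finite_T: "finite T"
    by (rule indexed_partition_finite[OF a])
  have finite_V: "finite (V t)" if "t \<in> T" for t
    by (rule indexed_partition_finite[OF p[OF that]])
  have nonzero: "?q y \<noteq> \<bottom>" if "y \<in> ?U" for y
    using that finite_T indexed_partition_nonzero[OF p] by (auto simp: finite_join_eq_bot_iff)
  have disjoint: "?q y \<sqinter> ?q z = \<bottom>" if "y \<noteq> z" for y z
  proof -
    have "p s y \<sqinter> p t z = \<bottom>" if "s \<in> T" "y \<in> V s" "t \<in> T" "z \<in> V t" for s t
    proof (cases "s = t")
      case True
      then show ?thesis
        using indexed_partition_disjoint[OF p] that \<open>y \<noteq> z\<close> by blast
    next
      case False
      then show ?thesis
        using that by (intro disjoint_mono[of "p s y" "a s" "p t z" "a t"]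
            indexed_partition_le[OF p] indexed_partition_disjoint[OF a])
    qed
    then show ?thesis
      using finite_T by (auto simp: disjoint_finite_joins_iff)
  qed
  have "finite_join (?q ` ?U) = finite_join ((\<lambda>t. finite_join (p t ` V t)) ` T)"
    using finite_T finite_V by (rule finite_join_swap)
  also have "\<dots> = \<alpha>"
    using indexed_partition_join[OF p] indexed_partition_join[OF a] by (simp cong: image_cong)
  finally show ?thesis
    using finite_T finite_V nonzero disjoint by (auto simp: indexed_partition_def pairwise_def)
qed

lemma indexed_partition_join_Diff:
  assumes p: "indexed_partition p U a" and "S \<subseteq> U" "T \<subseteq> U"
  shows "finite_join (p ` (S - T)) = finite_join (p ` S) \<sqinter> - finite_join (p ` T)"
proof -
  have fin: "finite S" "finite T"
    using indexed_partition_finite[OF p] assms(2,3) by (auto intro: finite_subset)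
  have "finite_join (p ` (S - T)) \<sqinter> finite_join (p ` T) = \<bottom>"
    using fin assms(2,3) indexed_partition_disjoint[OF p] by (auto simp: disjoint_finite_joins_iff)
  then have "finite_join (p ` (S - T)) \<le> - finite_join (p ` T)"
    by (simp add: inf_shunt)
  moreover have "finite_join (p ` (S \<inter> T)) \<le> finite_join (p ` T)"
    using fin by (intro finite_join.subset_imp) auto
  then have "finite_join (p ` (S \<inter> T)) \<sqinter> - finite_join (p ` T) = \<bottom>"
    by (simp add: inf_shunt)
  moreover have "finite_join (p ` S) = finite_join (p ` (S - T)) \<squnion> finite_join (p ` (S \<inter> T))"
    using fin by (simp add: Un_Diff_Int flip: finite_join.union image_Un)
  ultimately show ?thesis
    by (simp add: inf_sup_distrib2 inf.absorb1)
qed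

lemma indexed_partition_join_Int:
  assumes p: "indexed_partition p U a" and "S \<subseteq> U" "T \<subseteq> U"
  shows "finite_join (p ` (S \<inter> T)) = finite_join (p ` S) \<sqinter> finite_join (p ` T)"
proof -
  have "S \<inter> T = S - (S - T)" and "S - T \<subseteq> U"
    using assms(2) by auto
  then show ?thesis
    using indexed_partition_join_Diff[OF p] assms(2,3) by (simp add: inf_sup_distrib1)
qed

lemma inj_on_indexed_partition_join:
  assumes p: "indexed_partition p U a"
  shows "inj_on (\<lambda>S. finite_join (p ` S)) (Pow U)"
proof (rule inj_onI)
  have "S \<subseteq> T"
    if "S \<subseteq> U" "T \<subseteq> U" and eq: "finite_join (p ` S) = finite_join (p ` T)" for S T
  proof -
    have "finite (S - T)"
      using indexed_partition_finite[OF p] that(1) by (auto intro: finite_subset)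
    moreover have "finite_join (p ` (S - T)) = \<bottom>"
      using indexed_partition_join_Diff[OF p that(1,2)] eq by simp
    ultimately have "\<forall>s\<in>S - T. p s = \<bottom>"
      by (simp add: finite_join_eq_bot_iff)
    then show ?thesis
      using indexed_partition_nonzero[OF p] that(1) by blast
  qed
  then show "S = T"
    if "S \<in> Pow U" "T \<in> Pow U" "finite_join (p ` S) = finite_join (p ` T)" for S T
    using that by (metis PowD subset_antisym)
qed

section \<open>Dissectable and totally disconnected algebras\<close>

definition boundary :: "('b::boolean_algebra \<Rightarrow> 'b) \<Rightarrow> 'b \<Rightarrow> 'b" where
  "boundary C a = C a \<sqinter> - a"

lemma ex_map_eq:
  assumes "distinct xs" and "length xs = length ys"
  shows "\<exists>f. map f xs = ys"
proof
  show "map (the \<circ> map_of (zip xs ys)) xs = ys"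
    using assms by (intro nth_equalityI) (simp_all add: map_of_zip_nth)
qed

lemma pairwise_set_of_sorted_wrt:
  assumes "sorted_wrt P xs" and "symp P"
  shows "pairwise P (set xs)"
  using assms by (induction xs) (auto simp: pairwise_insert dest: sympD)

lemma dissectable_indexed:
  assumes dis: "dissectable C" and \<alpha>: "open_element C \<alpha>" "\<alpha> \<noteq> \<bottom>"
    and fin: "finite T" "finite K" and "K \<noteq> {}" and "T \<inter> K = {}"
  obtains p where "indexed_partition p (T \<union> K) \<alpha>"
    and "\<And>t. t \<in> T \<Longrightarrow> open_element C (p t)"
    and "\<And>t. t \<in> T \<Longrightarrow> boundary C (p t) = C \<alpha> \<sqinter> - finite_join (p ` T)"
    and "\<And>k. k \<in> K \<Longrightarrow> C (p k) = C \<alpha> \<sqinter> - finite_join (p ` T)"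
proof -
  obtain ts where ts: "set ts = T" "distinct ts"
    using finite_distinct_list[OF fin(1)] by blast
  obtain ks where ks: "set ks = K" "distinct ks"
    using finite_distinct_list[OF fin(2)] by blast
  have "open_element C \<alpha> \<and> \<alpha> \<noteq> \<bottom> \<and> length ks \<ge> 1"
    using \<alpha> \<open>K \<noteq> {}\<close> ks(1) by (cases ks) auto
  then obtain as bs where len: "length as = length ts" "length bs = length ks"
    and nonzero: "\<forall>x\<in>set (as @ bs). x \<noteq> \<bottom>"
    and disjoint: "sorted_wrt (\<lambda>x y. x \<sqinter> y = \<bottom>) (as @ bs)"
    and join: "list_join (as @ bs) = \<alpha>"
    and as: "\<forall>a\<in>set as. open_element C a" "\<forall>a\<in>set as. C a \<sqinter> - a = C \<alpha> \<sqinter> - list_join as"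
    and bs: "\<forall>b\<in>set bs. C b = C \<alpha> \<sqinter> - list_join as"
    using dis[unfolded dissectable_def, THEN spec, THEN spec[of _ "length ts"], THEN spec, THEN mp]
    by blast
  have "distinct (ts @ ks)"
    using ts ks \<open>T \<inter> K = {}\<close> by simp
  then obtain p where p: "map p (ts @ ks) = as @ bs"
    using ex_map_eq[of "ts @ ks" "as @ bs"] len by auto
  then have as_eq: "as = map p ts" and bs_eq: "bs = map p ks"
    using len by auto
  have "symp (\<lambda>s t. p s \<sqinter> p t = \<bottom>)"
    by (rule sympI) (simp add: inf_commute)
  moreover have "sorted_wrt (\<lambda>s t. p s \<sqinter> p t = \<bottom>) (ts @ ks)"
    using disjoint unfolding p[symmetric] sorted_wrt_map .
  ultimately have "pairwise (\<lambda>s t. p s \<sqinter> p t = \<bottom>) (T \<union> K)"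
    using pairwise_set_of_sorted_wrt ts(1) ks(1) by fastforce
  then have "indexed_partition p (T \<union> K) \<alpha>"
    using fin nonzero join ts(1) ks(1)
    by (auto simp: indexed_partition_def as_eq bs_eq list_join_eq_finite_join image_Un)
  moreover have "list_join as = finite_join (p ` T)"
    using ts(1) by (simp add: as_eq list_join_eq_finite_join)
  ultimately show ?thesis
    using that as bs ts(1) ks(1) by (simp add: as_eq bs_eq boundary_def)
qed

lemma totally_disconnected_indexed:
  assumes disc: "totally_disconnected C" and "finite T" and "T \<noteq> {}"
    and "open_element C \<alpha>" and "\<alpha> \<noteq> \<bottom>"
  shows "\<exists>p. indexed_partition p T \<alpha> \<and> (\<forall>t\<in>T. open_element C (p t))"
  using assms(2-)
proof (induction T arbitrary: \<alpha> rule: finite_ne_induct)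
  case (singleton x)
  then show ?case
    by (intro exI[of _ "\<lambda>_. \<alpha>"]) (simp add: indexed_partition_def)
next
  case (insert x T)
  obtain c d where open_c: "open_element C c" "c \<noteq> \<bottom>" and open_d: "open_element C d" "d \<noteq> \<bottom>"
    and split: "c \<sqinter> d = \<bottom>" "c \<squnion> d = \<alpha>"
    using disc insert.prems unfolding totally_disconnected_def by metis
  obtain p where p: "indexed_partition p T d" "\<forall>t\<in>T. open_element C (p t)"
    using insert.IH[OF open_d] by blast
  have "indexed_partition (\<lambda>_. c) {x} c"
    using open_c(2) by (simp add: indexed_partition_def)
  then have "indexed_partition (override_on p (\<lambda>_. c) {x}) (T \<union> {x}) (d \<squnion> c)"
    using insert.hyps(3) split(1) by (intro indexed_partition_Un[OF p(1)]) (auto simp: inf_commute)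
  moreover have "d \<squnion> c = \<alpha>" "T \<union> {x} = insert x T"
    using split(2) by (auto simp: sup_commute)
  moreover have "\<forall>t\<in>insert x T. open_element C (override_on p (\<lambda>_. c) {x} t)"
    using open_c(1) p(2) by (simp add: override_on_def)
  ultimately show ?case
    by metis
qed

section \<open>Closure algebras\<close>

locale closure_algebra =
  fixes C :: "'b::boolean_algebra \<Rightarrow> 'b"
  assumes closure_operator: "closure_operator C"
begin

lemma closure_sup: "C (a \<squnion> b) = C a \<squnion> C b"
  using closure_operator by (simp add: closure_operator_def)

lemma closure_bot: "C \<bottom> = \<bottom>"
  using closure_operator by (simp add: closure_operator_def)

lemma closure_increasing: "a \<le> C a"
  using closure_operator by (simp add: closure_operator_def)

lemma closure_idem: "C (C a) = C a"
  using closure_operator by (simp add: closure_operator_def)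

lemma closure_mono: "a \<le> b \<Longrightarrow> C a \<le> C b"
  by (metis closure_sup le_iff_sup)

lemma closure_finite_join: "finite A \<Longrightarrow> C (finite_join A) = finite_join (C ` A)"
  by (induction A rule: finite_induct) (simp_all add: closure_sup closure_bot)

lemma closure_le_closure_finite_join: "finite A \<Longrightarrow> a \<in> A \<Longrightarrow> C a \<le> C (finite_join A)"
  by (intro closure_mono finite_join.coboundedI)

lemma reflp_le_closure: "reflp (\<lambda>a b. a \<le> C b)"
  by (rule reflpI) (rule closure_increasing)

lemma transp_le_closure: "transp (\<lambda>a b. a \<le> C b)"
  by (rule transpI) (metis closure_mono closure_idem order.trans)

lemma open_disjoint_closure:
  assumes "open_element C a" and "a \<sqinter> b = \<bottom>"
  shows "a \<sqinter> C b = \<bottom>"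
proof -
  have "C (- a) = - a"
    using assms(1) by (metis open_element_def interior_op_def double_compl)
  moreover have "b \<le> - a"
    using assms(2) by (simp add: inf_shunt inf_commute[of a])
  ultimately have "C b \<le> - a"
    using closure_mono by metis
  then show ?thesis
    by (simp add: inf_shunt inf_commute[of a])
qed

end

section \<open>Realizing preorders by partitions\<close>

definition realization ::
  "('b::boolean_algebra \<Rightarrow> 'b) \<Rightarrow> ('w \<Rightarrow> 'w \<Rightarrow> bool) \<Rightarrow> 'w set \<Rightarrow> 'b \<Rightarrow> ('w \<Rightarrow> 'b) \<Rightarrow> bool" where
  "realization C R U \<alpha> g \<longleftrightarrow>
     indexed_partition g U \<alpha> \<and>
     (\<forall>y\<in>U. \<forall>z\<in>U. if R z y then g z \<le> C (g y) else g z \<sqinter> C (g y) = \<bottom>)"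

lemma realizationI:
  assumes "indexed_partition g U \<alpha>"
    and "\<And>y z. y \<in> U \<Longrightarrow> z \<in> U \<Longrightarrow> R z y \<Longrightarrow> g z \<le> C (g y)"
    and "\<And>y z. y \<in> U \<Longrightarrow> z \<in> U \<Longrightarrow> \<not> R z y \<Longrightarrow> g z \<sqinter> C (g y) = \<bottom>"
  shows "realization C R U \<alpha> g"
  using assms by (simp add: realization_def)

lemma realization_partition: "realization C R U \<alpha> g \<Longrightarrow> indexed_partition g U \<alpha>"
  by (simp add: realization_def)

lemma realization_le_closure:
  "realization C R U \<alpha> g \<Longrightarrow> y \<in> U \<Longrightarrow> z \<in> U \<Longrightarrow> R z y \<Longrightarrow> g z \<le> C (g y)"
  by (auto simp: realization_def)

lemma realization_disjoint_closure:
  "realization C R U \<alpha> g \<Longrightarrow> y \<in> U \<Longrightarrow> z \<in> U \<Longrightarrow> \<not> R z y \<Longrightarrow> g z \<sqinter> C (g y) = \<bottom>"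
  by (auto simp: realization_def)

lemma realization_ordinal_sum:
  assumes h: "realization C R T \<tau> h" and b: "realization C R K \<kappa> b"
    and disjoint_indices: "T \<inter> K = {}" and "\<tau> \<sqinter> \<kappa> = \<bottom>"
    and below: "\<And>k t. k \<in> K \<Longrightarrow> t \<in> T \<Longrightarrow> R k t \<and> b k \<le> C (h t)"
    and not_above: "\<And>t k. t \<in> T \<Longrightarrow> k \<in> K \<Longrightarrow> \<not> R t k \<and> h t \<sqinter> C (b k) = \<bottom>"
  shows "realization C R (T \<union> K) (\<tau> \<squnion> \<kappa>) (override_on h b K)"
proof (rule realizationI)
  show "indexed_partition (override_on h b K) (T \<union> K) (\<tau> \<squnion> \<kappa>)"
    using realization_partition[OF h] realization_partition[OF b] disjoint_indices \<open>\<tau> \<sqinter> \<kappa> = \<bottom>\<close>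
    by (rule indexed_partition_Un)
  have on_T: "override_on h b K t = h t" if "t \<in> T" for t
    using that disjoint_indices by (auto simp: override_on_def)
  show "override_on h b K z \<le> C (override_on h b K y)"
    if "y \<in> T \<union> K" "z \<in> T \<union> K" "R z y" for y z
    using that on_T below not_above realization_le_closure[OF h] realization_le_closure[OF b]
    by auto
  show "override_on h b K z \<sqinter> C (override_on h b K y) = \<bottom>"
    if "y \<in> T \<union> K" "z \<in> T \<union> K" "\<not> R z y" for y z
    using that on_T below not_above
      realization_disjoint_closure[OF h] realization_disjoint_closure[OF b]
    by auto
qed

definition boundary_realization ::
  "('b::boolean_algebra \<Rightarrow> 'b) \<Rightarrow> ('w \<Rightarrow> 'w \<Rightarrow> bool) \<Rightarrow> 'w set \<Rightarrow> 'b \<Rightarrow> ('w \<Rightarrow> 'b) \<Rightarrow> bool" where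
  "boundary_realization C R U \<alpha> g \<longleftrightarrow>
     realization C R U \<alpha> g \<and> (\<forall>y\<in>U. boundary C \<alpha> \<le> C (g y))"

context closure_algebra
begin

lemma realization_refine:
  assumes a: "indexed_partition a T \<alpha>" and open_pieces: "\<And>t. t \<in> T \<Longrightarrow> open_element C (a t)"
    and g: "\<And>t. t \<in> T \<Longrightarrow> realization C R (V t) (a t) (g t)"
    and up: "\<And>t y z. t \<in> T \<Longrightarrow> z \<in> V t \<Longrightarrow> y \<in> (\<Union>t\<in>T. V t) \<Longrightarrow> R z y \<Longrightarrow> y \<in> V t"
  shows "realization C R (\<Union>t\<in>T. V t) \<alpha> (\<lambda>y. finite_join ((\<lambda>t. g t y) ` {t \<in> T. y \<in> V t}))"
    (is "realization C R ?U \<alpha> ?h")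
proof -
  have fin: "finite T"
    by (rule indexed_partition_finite[OF a])
  have part: "indexed_partition (g t) (V t) (a t)" if "t \<in> T" for t
    by (rule realization_partition[OF g[OF that]])
  have related: "?h z \<le> C (?h y)" if "y \<in> ?U" "R z y" for y z
  proof -
    have "g t z \<le> C (?h y)" if t: "t \<in> T" "z \<in> V t" for t
    proof -
      have y: "y \<in> V t"
        using up[OF t \<open>y \<in> ?U\<close> \<open>R z y\<close>] .
      then have "g t z \<le> C (g t y)"
        using realization_le_closure[OF g] t \<open>R z y\<close> by blast
      also have "\<dots> \<le> C (?h y)"
        using fin t(1) y by (intro closure_le_closure_finite_join) auto
      finally show ?thesis .
    qed
    then show ?thesis
      using fin by (auto simp: finite_join.bounded_iff)
  qed
  have unrelated: "?h z \<sqinter> C (?h y) = \<bottom>" if "\<not> R z y" for y z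
  proof -
    have "g s z \<sqinter> C (g t y) = \<bottom>" if s: "s \<in> T" "z \<in> V s" and t: "t \<in> T" "y \<in> V t" for s t
    proof (cases "s = t")
      case True
      then show ?thesis
        using realization_disjoint_closure[OF g] s t \<open>\<not> R z y\<close> by blast
    next
      case False
      then have "a s \<sqinter> C (a t) = \<bottom>"
        using open_disjoint_closure[OF open_pieces] indexed_partition_disjoint[OF a] s(1) t(1) by blast
      then show ?thesis
        using indexed_partition_le[OF part] closure_mono s t by (blast intro: disjoint_mono)
    qed
    then show ?thesis
      using fin by (auto simp: closure_finite_join disjoint_finite_joins_iff)
  qed
  show ?thesis
    using indexed_partition_refine[OF a part] related unrelated by (rule realizationI)
qed

lemma realization_of_up_sets:
  assumes "reflp R" and "transp R"
    and p: "indexed_partition p T \<tau>" "\<And>t. t \<in> T \<Longrightarrow> open_element C (p t)"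
    and up_sets: "\<And>t. t \<in> T \<Longrightarrow> \<exists>g. boundary_realization C R {y \<in> T. R t y} (p t) g"
  shows "\<exists>h. realization C R T \<tau> h \<and> (\<forall>y\<in>T. boundary C (p y) \<le> C (h y))"
proof -
  obtain g where "\<And>t. t \<in> T \<Longrightarrow> boundary_realization C R {y \<in> T. R t y} (p t) (g t)"
    using up_sets by metis
  then have g: "\<And>t. t \<in> T \<Longrightarrow> realization C R {y \<in> T. R t y} (p t) (g t)"
    and g_boundary: "\<And>t y. t \<in> T \<Longrightarrow> y \<in> T \<Longrightarrow> R t y \<Longrightarrow> boundary C (p t) \<le> C (g t y)"
    by (auto simp: boundary_realization_def)
  define h where "h y = finite_join ((\<lambda>t. g t y) ` {t \<in> T. y \<in> {y \<in> T. R t y}})" for y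
  have "realization C R (\<Union>t\<in>T. {y \<in> T. R t y}) \<tau> h"
    unfolding h_def
    by (rule realization_refine[OF p g]) (auto intro: transpD[OF \<open>transp R\<close>])
  moreover have "(\<Union>t\<in>T. {y \<in> T. R t y}) = T"
    using \<open>reflp R\<close> by (auto dest: reflpD)
  moreover have "boundary C (p y) \<le> C (h y)" if "y \<in> T" for y
  proof -
    have "R y y"
      using \<open>reflp R\<close> by (rule reflpD)
    then have "boundary C (p y) \<le> C (g y y)"
      using g_boundary that by simp
    also have "\<dots> \<le> C (h y)"
      unfolding h_def using \<open>R y y\<close> that indexed_partition_finite[OF p(1)]
      by (intro closure_le_closure_finite_join) auto
    finally show ?thesis .
  qed
  ultimately show ?thesis
    by auto
qed

lemma realization_of_cluster:
  assumes "indexed_partition b K \<kappa>" and "\<And>k. k \<in> K \<Longrightarrow> C (b k) = \<delta>"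
    and "\<And>k l. k \<in> K \<Longrightarrow> l \<in> K \<Longrightarrow> R k l"
  shows "realization C R K \<kappa> b"
  using assms closure_increasing by (intro realizationI) metis+

lemma boundary_realization_of_dissection:
  assumes dis: "dissectable C" and R: "reflp R" "transp R"
    and \<alpha>: "open_element C \<alpha>" "\<alpha> \<noteq> \<bottom>"
    and fin: "finite T" "finite K" and "K \<noteq> {}" and disjoint_indices: "T \<inter> K = {}"
    and below: "\<And>k y. k \<in> K \<Longrightarrow> y \<in> T \<union> K \<Longrightarrow> R k y"
    and not_above: "\<And>t k. t \<in> T \<Longrightarrow> k \<in> K \<Longrightarrow> \<not> R t k"
    and up_sets: "\<And>t a. t \<in> T \<Longrightarrow> open_element C a \<Longrightarrow> a \<noteq> \<bottom> \<Longrightarrow>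
                    \<exists>g. boundary_realization C R {y \<in> T. R t y} a g"
  shows "\<exists>g. boundary_realization C R (T \<union> K) \<alpha> g"
proof -
  obtain p where p: "indexed_partition p (T \<union> K) \<alpha>"
    and p_open: "\<And>t. t \<in> T \<Longrightarrow> open_element C (p t)"
    and p_boundary: "\<And>t. t \<in> T \<Longrightarrow> boundary C (p t) = C \<alpha> \<sqinter> - finite_join (p ` T)"
    and p_closure: "\<And>k. k \<in> K \<Longrightarrow> C (p k) = C \<alpha> \<sqinter> - finite_join (p ` T)"
    using dissectable_indexed[OF dis \<alpha> fin \<open>K \<noteq> {}\<close> disjoint_indices] by blast
  let ?\<tau> = "finite_join (p ` T)" and ?\<kappa> = "finite_join (p ` K)"
  define \<delta> where "\<delta> = C \<alpha> \<sqinter> - ?\<tau>"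
  have parts: "indexed_partition p T ?\<tau>" "indexed_partition p K ?\<kappa>"
    by (auto intro: indexed_partition_subset[OF p])
  have \<alpha>_eq: "\<alpha> = ?\<tau> \<squnion> ?\<kappa>"
    using indexed_partition_join[OF p] fin by (simp add: image_Un finite_join.union)
  obtain h where h: "realization C R T ?\<tau> h"
    and h_boundary: "\<forall>y\<in>T. boundary C (p y) \<le> C (h y)"
    using realization_of_up_sets[OF R parts(1) p_open] up_sets p_open
      indexed_partition_nonzero[OF parts(1)] by blast
  have cluster: "realization C R K ?\<kappa> p"
    by (rule realization_of_cluster[OF parts(2) p_closure]) (use below in auto)
  have closure_p: "p k \<le> \<delta>" "C (p k) = \<delta>" if "k \<in> K" for k
    using closure_increasing[of "p k"] p_closure[OF that] by (simp_all add: \<delta>_def)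
  have closure_h: "\<delta> \<le> C (h t)" if "t \<in> T" for t
    using h_boundary p_boundary that by (simp add: \<delta>_def)
  have "h t \<sqinter> \<delta> = \<bottom>" if "t \<in> T" for t
    using indexed_partition_le[OF realization_partition[OF h] that]
    by (auto simp: \<delta>_def inf_shunt intro: order.trans le_supI2)
  moreover have "?\<tau> \<sqinter> ?\<kappa> = \<bottom>"
    using fin disjoint_indices indexed_partition_disjoint[OF p] by (auto simp: disjoint_finite_joins_iff)
  ultimately have "realization C R (T \<union> K) \<alpha> (override_on h p K)"
    unfolding \<alpha>_eq using below not_above order.trans[OF closure_p(1) closure_h] closure_p(2)
    by (intro realization_ordinal_sum[OF h cluster disjoint_indices]) auto
  moreover have "boundary C \<alpha> \<le> \<delta>"
    unfolding boundary_def \<delta>_def by (intro inf_mono) (simp_all add: \<alpha>_eq)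
  then have "boundary C \<alpha> \<le> C (override_on h p K y)" if "y \<in> T \<union> K" for y
    using that closure_h closure_p(2) by (auto simp: override_on_def intro: order.trans)
  ultimately show ?thesis
    by (auto simp: boundary_realization_def)
qed

lemma rooted_boundary_realization:
  assumes dis: "dissectable C" and R: "reflp R" "transp R"
    and "finite U" "x \<in> U" "\<And>y. y \<in> U \<Longrightarrow> R x y"
    and "open_element C \<alpha>" "\<alpha> \<noteq> \<bottom>"
  shows "\<exists>g. boundary_realization C R U \<alpha> g"
  using assms(4-)
proof (induction U arbitrary: x \<alpha> rule: finite_psubset_induct)
  case (psubset U)
  note root = psubset.prems(1,2)
  have refl: "R y y" for y
    using R(1) by (rule reflpD)
  have trans: "R y w" if "R y z" "R z w" for y z w
    using R(2) that by (rule transpD)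
  define K where "K = {y \<in> U. R y x}"
  define T where "T = {y \<in> U. \<not> R y x}"
  have "\<exists>g. boundary_realization C R (T \<union> K) \<alpha> g"
  proof (rule boundary_realization_of_dissection[OF dis R psubset.prems(3,4)])
    show "finite T" "finite K" "K \<noteq> {}" "T \<inter> K = {}"
      using psubset.hyps root(1) refl by (auto simp: T_def K_def)
    show "R k y" if "k \<in> K" "y \<in> T \<union> K" for k y
      using that root(2) trans[of k x y] by (auto simp: T_def K_def)
    show "\<not> R t k" if "t \<in> T" "k \<in> K" for t k
      using that trans[of t k x] by (auto simp: T_def K_def)
    show "\<exists>g. boundary_realization C R {y \<in> T. R t y} a g"
      if "t \<in> T" "open_element C a" "a \<noteq> \<bottom>" for t a
    proof (rule psubset.IH)
      show "{y \<in> T. R t y} \<subset> U"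
        using root(1) refl by (auto simp: T_def)
      show "t \<in> {y \<in> T. R t y}"
        using that refl by simp
    qed (use that in auto)
  qed
  moreover have "T \<union> K = U"
    by (auto simp: T_def K_def)
  ultimately show ?case
    by simp
qed

lemma finite_preorder_realization:
  assumes "totally_disconnected C" and "dissectable C" and R: "reflp R" "transp R"
    and W: "finite W" "W \<noteq> {}" and \<alpha>: "open_element C \<alpha>" "\<alpha> \<noteq> \<bottom>"
  obtains g where "realization C R W \<alpha> g"
proof -
  obtain p where p: "indexed_partition p W \<alpha>" "\<And>t. t \<in> W \<Longrightarrow> open_element C (p t)"
    using totally_disconnected_indexed[OF assms(1) W \<alpha>] by blast
  have "\<exists>g. boundary_realization C R {y \<in> W. R t y} (p t) g" if "t \<in> W" for t
    using W(1) that p indexed_partition_nonzero[OF p(1) that] reflpD[OF R(1)]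
    by (intro rooted_boundary_realization[OF assms(2) R, of _ t]) auto
  then show ?thesis
    using realization_of_up_sets[OF R p] that by blast
qed

lemma realization_closure_join:
  assumes g: "realization C R U \<alpha> g" and "S \<subseteq> U"
  shows "\<alpha> \<sqinter> C (finite_join (g ` S)) = finite_join (g ` {z \<in> U. \<exists>y\<in>S. R z y})"
proof -
  let ?D = "{z \<in> U. \<exists>y\<in>S. R z y}"
  let ?c = "C (finite_join (g ` S))"
  have part: "indexed_partition g U \<alpha>"
    by (rule realization_partition[OF g])
  then have fin: "finite U" "finite S"
    using \<open>S \<subseteq> U\<close> by (auto dest: indexed_partition_finite intro: finite_subset)
  have closure_join: "?c = finite_join ((\<lambda>y. C (g y)) ` S)"
    using fin by (simp add: closure_finite_join image_image)
  have "g z \<le> ?c" if z: "z \<in> ?D" for z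
  proof -
    obtain y where y: "y \<in> S" "R z y"
      using z by blast
    then have "g z \<le> C (g y)"
      using realization_le_closure[OF g] z \<open>S \<subseteq> U\<close> by blast
    also have "\<dots> \<le> ?c"
      using fin y(1) by (intro closure_le_closure_finite_join) auto
    finally show ?thesis .
  qed
  then have "finite_join (g ` ?D) \<le> ?c"
    using fin by (simp add: finite_join.bounded_iff)
  moreover have "finite_join (g ` (U - ?D)) \<sqinter> ?c = \<bottom>"
    unfolding closure_join using fin realization_disjoint_closure[OF g] \<open>S \<subseteq> U\<close>
    by (auto simp: disjoint_finite_joins_iff)
  moreover have "\<alpha> = finite_join (g ` ?D) \<squnion> finite_join (g ` (U - ?D))"
  proof -
    have "g ` U = g ` ?D \<union> g ` (U - ?D)"
      by blast
    then show ?thesis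
      using indexed_partition_join[OF part] fin by (simp add: finite_join.union)
  qed
  ultimately show ?thesis
    by (simp add: inf_sup_distrib2 inf.absorb1)
qed

end

section \<open>Atoms of finite Boolean algebras\<close>

definition atoms :: "'a::order_bot set" where
  "atoms = {w. w \<noteq> \<bottom> \<and> (\<forall>v\<le>w. v = \<bottom> \<or> v = w)}"

definition atoms_below :: "'a::order_bot \<Rightarrow> 'a set" where
  "atoms_below x = {w \<in> atoms. w \<le> x}"

lemma atom_le_compl_iff:
  fixes w x :: "'a::boolean_algebra"
  assumes "w \<in> atoms"
  shows "w \<le> - x \<longleftrightarrow> \<not> w \<le> x"
proof -
  have "w \<sqinter> x = \<bottom> \<or> w \<sqinter> x = w" and "w \<noteq> \<bottom>"
    using assms inf_le1[of w x] by (auto simp: atoms_def)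
  then show ?thesis
    by (metis inf_shunt inf.absorb_iff1)
qed

lemma atoms_below_subset: "atoms_below x \<subseteq> atoms"
  by (auto simp: atoms_below_def)

lemma atoms_below_bot: "atoms_below \<bottom> = ({} :: 'a::order_bot set)"
  by (auto simp: atoms_below_def atoms_def bot_unique)

lemma atoms_below_top: "atoms_below \<top> = (atoms :: 'a::bounded_lattice set)"
  by (simp add: atoms_below_def)

lemma atoms_below_inf:
  fixes x y :: "'a::bounded_lattice_bot"
  shows "atoms_below (x \<sqinter> y) = atoms_below x \<inter> atoms_below y"
  by (auto simp: atoms_below_def)

lemma atoms_below_compl:
  fixes x :: "'a::boolean_algebra"
  shows "atoms_below (- x) = atoms - atoms_below x"
  by (auto simp: atoms_below_def atom_le_compl_iff)

lemma atoms_below_sup: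
  fixes x y :: "'a::boolean_algebra"
  shows "atoms_below (x \<squnion> y) = atoms_below x \<union> atoms_below y"
proof -
  have "atoms_below (x \<squnion> y) = atoms_below (- (- x \<sqinter> - y))"
    by simp
  also have "\<dots> = atoms_below x \<union> atoms_below y"
    unfolding atoms_below_compl atoms_below_inf using atoms_below_subset by blast
  finally show ?thesis .
qed

lemma atoms_below_finite_join:
  fixes A :: "'a::boolean_algebra set"
  assumes "finite A"
  shows "atoms_below (finite_join A) = (\<Union>a\<in>A. atoms_below a)"
  using assms by (induction A rule: finite_induct) (simp_all add: atoms_below_bot atoms_below_sup)

lemma atoms_below_nonempty:
  fixes x :: "'a::order_bot"
  assumes "finite {..x}" and "x \<noteq> \<bottom>"
  shows "atoms_below x \<noteq> {}"
proof -
  let ?N = "{..x} - {\<bottom>}"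
  obtain w where "w \<in> ?N" "\<And>v. v \<in> ?N \<Longrightarrow> v \<le> w \<Longrightarrow> w = v"
    using finite_has_minimal2[of ?N x] assms by auto
  then have "w \<in> atoms_below x"
    by (auto simp: atoms_below_def atoms_def intro: order.trans)
  then show ?thesis
    by blast
qed

lemma finite_join_atoms_below:
  fixes x :: "'a::boolean_algebra"
  assumes "finite {..x}"
  shows "finite_join (atoms_below x) = x"
proof (rule order.antisym)
  have fin: "finite (atoms_below x)"
    using assms by (rule rev_finite_subset) (auto simp: atoms_below_def)
  then show "finite_join (atoms_below x) \<le> x"
    by (auto simp: finite_join.bounded_iff atoms_below_def)
  let ?d = "x \<sqinter> - finite_join (atoms_below x)"
  have "atoms_below (finite_join (atoms_below x)) = atoms_below x"
    unfolding atoms_below_finite_join[OF fin] by (auto simp: atoms_below_def)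
  then have "atoms_below ?d = {}"
    unfolding atoms_below_inf atoms_below_compl by blast
  moreover have "finite {..?d}"
    using assms by (rule rev_finite_subset) auto
  ultimately have "?d = \<bottom>"
    using atoms_below_nonempty by blast
  then show "x \<le> finite_join (atoms_below x)"
    by (simp add: inf_shunt)
qed

lemma inj_atoms_below:
  assumes "finite (UNIV :: 'a::boolean_algebra set)"
  shows "inj (atoms_below :: 'a \<Rightarrow> 'a set)"
  using finite_join_atoms_below[OF finite_subset[OF subset_UNIV assms]]
  by (rule inj_on_inverseI)

lemma (in closure_algebra) atoms_below_closure:
  assumes "finite {..x}"
  shows "atoms_below (C x) = {w \<in> atoms. \<exists>v\<in>atoms_below x. w \<le> C v}"
proof -
  have fin: "finite (atoms_below x)"
    using assms by (rule rev_finite_subset) (auto simp: atoms_below_def)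
  have "C x = finite_join (C ` atoms_below x)"
    using closure_finite_join[OF fin] finite_join_atoms_below[OF assms] by simp
  then show ?thesis
    using fin by (auto simp: atoms_below_finite_join) (auto simp: atoms_below_def)
qed

section \<open>Closure embeddings\<close>

lemma boolean_hom_rel_of_atom_partition:
  fixes g :: "'a::boolean_algebra \<Rightarrow> 'b::boolean_algebra"
  assumes g: "indexed_partition g atoms \<alpha>"
  shows "boolean_hom_rel (\<lambda>x. finite_join (g ` atoms_below x)) \<alpha>"
proof -
  let ?f = "\<lambda>x. finite_join (g ` atoms_below x)"
  have fin: "finite (atoms_below x)" for x :: 'a
    using atoms_below_subset indexed_partition_finite[OF g] by (rule finite_subset)
  have join_atoms: "finite_join (g ` atoms) = \<alpha>"
    by (rule indexed_partition_join[OF g])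
  have "?f x \<le> \<alpha>" for x
    using fin[of x] indexed_partition_le[OF g] atoms_below_subset[of x]
    by (auto simp: finite_join.bounded_iff)
  moreover have "?f (x \<squnion> y) = ?f x \<squnion> ?f y" for x y
    using fin by (simp add: atoms_below_sup image_Un finite_join.union)
  moreover have "?f (x \<sqinter> y) = ?f x \<sqinter> ?f y" for x y
    unfolding atoms_below_inf
    by (rule indexed_partition_join_Int[OF g atoms_below_subset atoms_below_subset])
  moreover have "?f (- x) = \<alpha> \<sqinter> - ?f x" for x
    using indexed_partition_join_Diff[OF g order.refl atoms_below_subset]
    by (simp add: atoms_below_compl join_atoms)
  moreover have "?f \<bottom> = \<bottom>"
    by (simp add: atoms_below_bot)
  moreover have "?f \<top> = \<alpha>"
    by (simp add: atoms_below_top join_atoms)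
  ultimately show ?thesis
    by (auto simp: boolean_hom_rel_def rel_carrier_def rel_compl_def)
qed

definition rel_closure :: "'b::boolean_algebra \<Rightarrow> ('b \<Rightarrow> 'b) \<Rightarrow> 'b \<Rightarrow> 'b" where
  "rel_closure \<alpha> C b = \<alpha> \<sqinter> C b"

definition closure_hom_rel ::
  "('a::boolean_algebra \<Rightarrow> 'a) \<Rightarrow> ('b::boolean_algebra \<Rightarrow> 'b) \<Rightarrow> 'b \<Rightarrow> ('a \<Rightarrow> 'b) \<Rightarrow> bool" where
  "closure_hom_rel CA CB \<alpha> f \<longleftrightarrow>
     boolean_hom_rel f \<alpha> \<and> (\<forall>x. f (CA x) = rel_closure \<alpha> CB (f x))"

lemma closure_embedding_of_realization:
  fixes CA :: "'a::boolean_algebra \<Rightarrow> 'a"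
  assumes "closure_algebra CA" and "closure_algebra CB" and fin: "finite (UNIV :: 'a set)"
    and g: "realization CB (\<lambda>w v. w \<le> CA v) atoms \<alpha> g"
  defines "f \<equiv> \<lambda>x. finite_join (g ` atoms_below x)"
  shows "closure_hom_rel CA CB \<alpha> f" and "inj f"
proof -
  interpret A: closure_algebra CA by fact
  interpret B: closure_algebra CB by fact
  have part: "indexed_partition g atoms \<alpha>"
    by (rule realization_partition[OF g])
  have "f (CA x) = rel_closure \<alpha> CB (f x)" for x
    using B.realization_closure_join[OF g atoms_below_subset[of x]]
      A.atoms_below_closure[OF finite_subset[OF subset_UNIV fin]]
    by (simp add: f_def rel_closure_def)
  then show "closure_hom_rel CA CB \<alpha> f"
    using boolean_hom_rel_of_atom_partition[OF part] by (simp add: closure_hom_rel_def f_def)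
  have "inj_on (\<lambda>S. finite_join (g ` S)) (range atoms_below)"
    using inj_on_indexed_partition_join[OF part] by (rule inj_on_subset) (use atoms_below_subset in blast)
  then show "inj f"
    using comp_inj_on[OF inj_atoms_below[OF fin]] by (simp add: f_def comp_def)
qed

section \<open>Tangled closure\<close>

definition tangled :: "('b::boolean_algebra \<Rightarrow> 'b) \<Rightarrow> 'b set \<Rightarrow> 'b \<Rightarrow> bool" where
  "tangled C \<Gamma> a \<longleftrightarrow> (\<forall>\<gamma>\<in>\<Gamma>. a \<le> C (\<gamma> \<sqinter> a))"

lemma closure_algebra_induced_closure:
  "tangled_closure_algebra Ct \<Longrightarrow> closure_algebra (induced_closure Ct)"
  by (simp add: tangled_closure_algebra_def closure_algebra_def)

lemma tangled_tangled_closure: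
  assumes "tangled_closure_algebra Ct" and "finite \<Gamma>"
  shows "tangled (induced_closure Ct) \<Gamma> (Ct \<Gamma>)"
  unfolding tangled_def
proof
  fix \<gamma> assume "\<gamma> \<in> \<Gamma>"
  then have "Ct \<Gamma> \<le> Inf_fin ((\<lambda>\<gamma>. induced_closure Ct (\<gamma> \<sqinter> Ct \<Gamma>)) ` \<Gamma>)"
    using assms unfolding tangled_closure_algebra_def by blast
  also have "\<dots> \<le> induced_closure Ct (\<gamma> \<sqinter> Ct \<Gamma>)"
    using assms(2) \<open>\<gamma> \<in> \<Gamma>\<close> by (intro Inf_fin.coboundedI) auto
  finally show "Ct \<Gamma> \<le> induced_closure Ct (\<gamma> \<sqinter> Ct \<Gamma>)" .
qed

lemma tangled_le_tangled_closure:
  assumes Ct: "tangled_closure_algebra Ct" and \<Gamma>: "finite \<Gamma>" "\<Gamma> \<noteq> {}"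
    and a: "tangled (induced_closure Ct) \<Gamma> a"
  shows "a \<le> Ct \<Gamma>"
proof -
  let ?m = "Inf_fin ((\<lambda>\<gamma>. induced_closure Ct (\<gamma> \<sqinter> a)) ` \<Gamma>)"
  have "a \<le> ?m"
    using \<Gamma> a by (intro Inf_fin.boundedI) (auto simp: tangled_def)
  then have "bimp a ?m = \<top>"
    unfolding bimp_def by (metis shunt1 inf_top_left top_unique)
  moreover have "interior_op (induced_closure Ct) \<top> = \<top>"
    using closure_algebra.closure_bot[OF closure_algebra_induced_closure[OF Ct]]
    by (simp add: interior_op_def)
  moreover have "interior_op (induced_closure Ct) (bimp a ?m) \<sqinter> a \<le> Ct \<Gamma>"
    using Ct \<Gamma> unfolding tangled_closure_algebra_def by blast
  ultimately show ?thesis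
    by simp
qed

lemma tangled_inf:
  assumes "tangled C \<Gamma> c" and "\<And>\<gamma>. \<gamma> \<in> \<Gamma> \<Longrightarrow> \<gamma> \<le> \<alpha>"
  shows "tangled C \<Gamma> (\<alpha> \<sqinter> c)"
  unfolding tangled_def
proof
  fix \<gamma> assume "\<gamma> \<in> \<Gamma>"
  then have "\<gamma> \<sqinter> (\<alpha> \<sqinter> c) = \<gamma> \<sqinter> c"
    using assms(2) by (simp add: inf.absorb1 flip: inf_assoc)
  then show "\<alpha> \<sqinter> c \<le> C (\<gamma> \<sqinter> (\<alpha> \<sqinter> c))"
    using assms(1) \<open>\<gamma> \<in> \<Gamma>\<close> by (simp add: tangled_def le_infI2)
qed

lemma closure_hom_rel_tangled:
  assumes f: "closure_hom_rel CA CB \<alpha> f" and a: "tangled CA \<Gamma> a"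
  shows "tangled CB (f ` \<Gamma>) (f a)"
  unfolding tangled_def
proof
  have f_inf: "f (x \<sqinter> y) = f x \<sqinter> f y" and f_closure: "f (CA x) \<le> CB (f x)" for x y
    using f by (simp_all add: closure_hom_rel_def boolean_hom_rel_def rel_closure_def)
  fix d assume "d \<in> f ` \<Gamma>"
  then obtain \<gamma> where \<gamma>: "\<gamma> \<in> \<Gamma>" "d = f \<gamma>"
    by blast
  have "a = CA (\<gamma> \<sqinter> a) \<sqinter> a"
    using a \<gamma>(1) by (simp add: tangled_def inf.absorb2)
  then have "f a \<le> f (CA (\<gamma> \<sqinter> a))"
    by (metis f_inf inf_le1)
  also have "\<dots> \<le> CB (d \<sqinter> f a)"
    using f_closure[of "\<gamma> \<sqinter> a"] by (simp add: f_inf \<gamma>(2))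
  finally show "f a \<le> CB (d \<sqinter> f a)" .
qed

lemma closure_hom_rel_tangled_adjoint:
  assumes f: "closure_hom_rel CA CB \<alpha> f" and CB: "closure_algebra CB"
    and b: "tangled CB (f ` \<Gamma>) b" "b \<le> \<alpha>" and adjoint: "\<And>x. b \<le> f x \<longleftrightarrow> a \<le> x"
  shows "tangled CA \<Gamma> a"
  unfolding tangled_def
proof
  have f_inf: "f (x \<sqinter> y) = f x \<sqinter> f y" and f_closure: "f (CA x) = \<alpha> \<sqinter> CB (f x)" for x y
    using f by (simp_all add: closure_hom_rel_def boolean_hom_rel_def rel_closure_def)
  fix \<gamma> assume "\<gamma> \<in> \<Gamma>"
  then have "b \<le> CB (f \<gamma> \<sqinter> b)"
    using b(1) by (simp add: tangled_def)
  also have "f \<gamma> \<sqinter> b \<le> f (\<gamma> \<sqinter> a)"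
    using adjoint[of a] by (simp add: f_inf le_infI2)
  then have "CB (f \<gamma> \<sqinter> b) \<le> CB (f (\<gamma> \<sqinter> a))"
    by (rule closure_algebra.closure_mono[OF CB])
  finally have "b \<le> f (CA (\<gamma> \<sqinter> a))"
    using b(2) by (simp add: f_closure)
  then show "a \<le> CA (\<gamma> \<sqinter> a)"
    by (simp add: adjoint)
qed

lemma ex_lower_adjoint:
  fixes f :: "'a::bounded_lattice_top \<Rightarrow> 'b::semilattice_inf"
  assumes fin: "finite (UNIV :: 'a set)" and f_inf: "\<And>x y. f (x \<sqinter> y) = f x \<sqinter> f y"
    and "b \<le> f \<top>"
  obtains a where "\<And>x. b \<le> f x \<longleftrightarrow> a \<le> x"
proof -
  let ?X = "{x. b \<le> f x}"
  have X: "finite ?X" "?X \<noteq> {}"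
    using finite_subset[OF subset_UNIV fin] \<open>b \<le> f \<top>\<close> by auto
  have "b \<le> f (Inf_fin S)" if "finite S" "S \<noteq> {}" "S \<subseteq> ?X" for S
    using that by (induction S rule: finite_ne_induct) (simp_all add: f_inf)
  then have "b \<le> f (Inf_fin ?X)"
    using X by blast
  moreover have "f x \<le> f y" if "x \<le> y" for x y
    using that by (metis f_inf inf.absorb_iff1)
  ultimately have "b \<le> f x \<longleftrightarrow> Inf_fin ?X \<le> x" for x
    using X by (auto intro: Inf_fin.coboundedI order.trans)
  then show ?thesis
    by (rule that)
qed

lemma closure_hom_rel_tangled_closure:
  fixes CtA :: "'a::boolean_algebra set \<Rightarrow> 'a" and CtB :: "'b::boolean_algebra set \<Rightarrow> 'b"
  assumes A: "tangled_closure_algebra CtA" and B: "tangled_closure_algebra CtB"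
    and fin: "finite (UNIV :: 'a set)"
    and f: "closure_hom_rel (induced_closure CtA) (induced_closure CtB) \<alpha> f"
    and \<Gamma>: "finite \<Gamma>" "\<Gamma> \<noteq> {}"
  shows "f (CtA \<Gamma>) = rel_tangle \<alpha> CtB (f ` \<Gamma>)"
proof (rule order.antisym)
  have f_inf: "f (x \<sqinter> y) = f x \<sqinter> f y" and f_top: "f \<top> = \<alpha>" and f_le_\<alpha>: "f x \<le> \<alpha>" for x y
    using f by (auto simp: closure_hom_rel_def boolean_hom_rel_def rel_carrier_def)
  have f_\<Gamma>: "finite (f ` \<Gamma>)" "f ` \<Gamma> \<noteq> {}"
    using \<Gamma> by auto
  have "f (CtA \<Gamma>) \<le> CtB (f ` \<Gamma>)"
    by (intro tangled_le_tangled_closure[OF B f_\<Gamma>] closure_hom_rel_tangled[OF f]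
        tangled_tangled_closure[OF A \<Gamma>(1)])
  then show "f (CtA \<Gamma>) \<le> rel_tangle \<alpha> CtB (f ` \<Gamma>)"
    using f_le_\<alpha> by (simp add: rel_tangle_def)
  define b where "b = rel_tangle \<alpha> CtB (f ` \<Gamma>)"
  have CB: "closure_algebra (induced_closure CtB)"
    by (rule closure_algebra_induced_closure[OF B])
  have b_tangled: "tangled (induced_closure CtB) (f ` \<Gamma>) b"
    unfolding b_def rel_tangle_def
    using tangled_tangled_closure[OF B f_\<Gamma>(1)] f_le_\<alpha> by (intro tangled_inf) auto
  have b_le_\<alpha>: "b \<le> \<alpha>"
    by (simp add: b_def rel_tangle_def)
  then obtain a where adjoint: "\<And>x. b \<le> f x \<longleftrightarrow> a \<le> x"
    using ex_lower_adjoint[OF fin, of f b] f_inf f_top by blast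
  have "a \<le> CtA \<Gamma>"
    by (rule tangled_le_tangled_closure[OF A \<Gamma>
          closure_hom_rel_tangled_adjoint[OF f CB b_tangled b_le_\<alpha> adjoint]])
  then show "rel_tangle \<alpha> CtB (f ` \<Gamma>) \<le> f (CtA \<Gamma>)"
    by (simp only: adjoint flip: b_def)
qed

theorem theorem4p3:
  fixes CtB :: "'b::boolean_algebra set \<Rightarrow> 'b"
    and \<alpha> :: 'b
    and CtA :: "'a::boolean_algebra set \<Rightarrow> 'a"
  assumes "tangled_closure_algebra CtB"
    and "totally_disconnected (induced_closure CtB)"
    and "dissectable (induced_closure CtB)"
    and "open_element (induced_closure CtB) \<alpha>"
    and "\<alpha> \<noteq> \<bottom>"
    and "tangled_closure_algebra CtA"
    and "finite (UNIV :: 'a set)"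
    and "(\<bottom> :: 'a) \<noteq> \<top>"
  shows "\<exists>f :: 'a \<Rightarrow> 'b. boolean_hom_rel f \<alpha> \<and> inj f \<and>
           (\<forall>\<Gamma>. finite \<Gamma> \<and> \<Gamma> \<noteq> {} \<longrightarrow> f (CtA \<Gamma>) = rel_tangle \<alpha> CtB (f ` \<Gamma>))"
proof -
  let ?CA = "induced_closure CtA" and ?CB = "induced_closure CtB"
  interpret A: closure_algebra ?CA
    by (rule closure_algebra_induced_closure) fact
  interpret B: closure_algebra ?CB
    by (rule closure_algebra_induced_closure) fact
  have fin: "finite S" for S :: "'a set"
    by (rule finite_subset[OF subset_UNIV assms(7)])
  have "(atoms :: 'a set) \<noteq> {}"
    using atoms_below_nonempty[OF fin, of \<top>] assms(8) by (simp add: atoms_below_top)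
  then obtain g where g: "realization ?CB (\<lambda>w v. w \<le> ?CA v) atoms \<alpha> g"
    using B.finite_preorder_realization[OF assms(2,3) A.reflp_le_closure A.transp_le_closure
        fin _ assms(4,5)]
    by blast
  obtain f where f: "closure_hom_rel ?CA ?CB \<alpha> f" "inj f"
    using closure_embedding_of_realization[OF A.closure_algebra_axioms B.closure_algebra_axioms
        assms(7) g]
    by blast
  then have "boolean_hom_rel f \<alpha>"
    by (simp add: closure_hom_rel_def)
  then show ?thesis
    using f closure_hom_rel_tangled_closure[OF assms(6,1,7) f(1)] by blast
qed

end
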